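(* Let $G=(V,E)$ be a graph of order $n$ such that, for some integer $k$ with $2\le k\le n/2$, we have $\alpha(F_k(G))=\alpha(G)$. Let $u,v\in V$ be distinct non-adjacent vertices and let $G+uv$ be the graph obtained from $G$ by adding the edge $uv$. If $\alpha(G+uv)=\alpha(G)$, then $\alpha(F_k(G+uv))=\alpha(G+uv)$.
   Context: For a graph $G$, $\alpha(G)$ denotes the algebraic connectivity of $G$, i.e. the second smallest eigenvalue of its Laplacian matrix $L(G)=D-A$ (eigenvalues counted with multiplicity). For a graph $G=(V,E)$ on $n$ vertices and an integer $1\le k\le n-1$, the $k$-token graph $F_k(G)$ has as vertices the $k$-subsets of $V$, two $k$-subsets $A,B$ being adjacent iff their symmetric difference is $\{a,b\}$ with $ab\in E$. *)

theory Defs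
  imports "Graph_Theory.Pair_Digraph" "Jordan_Normal_Form.Char_Poly"
begin

text \<open>
  Finite simple graphs are the library's \<^locale>\<open>pair_graph\<close>: a finite vertex set with a
  symmetric, irreflexive adjacency relation on it. As that relation contains both
  orientations of every edge, the degree of a vertex is its \<^const>\<open>out_degree\<close>.
\<close>

definition degree_matrix :: "'a pair_pre_digraph \<Rightarrow> 'a list \<Rightarrow> real mat" where
  "degree_matrix G vs = mat (length vs) (length vs)
     (\<lambda>(i, j). if i = j then real (out_degree (with_proj G) (vs ! i)) else 0)"

definition adjacency_matrix :: "'a pair_pre_digraph \<Rightarrow> 'a list \<Rightarrow> real mat" where
  "adjacency_matrix G vs = mat (length vs) (length vs)
     (\<lambda>(i, j). if (vs ! i, vs ! j) \<in> parcs G then 1 else 0)"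

definition laplacian_matrix :: "'a pair_pre_digraph \<Rightarrow> 'a list \<Rightarrow> real mat" where
  "laplacian_matrix G vs = degree_matrix G vs - adjacency_matrix G vs"

definition vertex_list :: "'a pair_pre_digraph \<Rightarrow> 'a list" where
  "vertex_list G = (SOME vs. distinct vs \<and> set vs = pverts G)"

text \<open>
  The Laplacian is a real symmetric matrix, so its eigenvalues with multiplicity are the real
  roots of its characteristic polynomial with multiplicity. Indices start at 0. The value is
  unspecified for graphs with fewer than two vertices.
\<close>

definition laplacian_spectrum :: "'a pair_pre_digraph \<Rightarrow> real multiset" where
  "laplacian_spectrum G = proots (char_poly (laplacian_matrix G (vertex_list G)))"

definition algebraic_connectivity :: "'a pair_pre_digraph \<Rightarrow> real" where
  "algebraic_connectivity G = sorted_list_of_multiset (laplacian_spectrum G) ! 1"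

definition token_graph :: "nat \<Rightarrow> 'a pair_pre_digraph \<Rightarrow> 'a set pair_pre_digraph" where
  "token_graph k G =
     \<lparr> pverts = {A. A \<subseteq> pverts G \<and> card A = k},
       parcs = {(A, B). A \<subseteq> pverts G \<and> card A = k \<and> B \<subseteq> pverts G \<and> card B = k \<and>
                        (\<exists>a b. sym_diff A B = {a, b} \<and> (a, b) \<in> parcs G)} \<rparr>"

definition add_edge :: "'a pair_pre_digraph \<Rightarrow> 'a \<Rightarrow> 'a \<Rightarrow> 'a pair_pre_digraph" where
  "add_edge G u v = \<lparr> pverts = pverts G, parcs = parcs G \<union> {(u, v), (v, u)} \<rparr>"

text \<open>The spectrum does not depend on the enumeration chosen by \<^const>\<open>vertex_list\<close>.\<close>

lemma vertex_list:
  assumes "finite (pverts G)"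
  shows "distinct (vertex_list G)" and "set (vertex_list G) = pverts G"
proof -
  have "\<exists>vs. distinct vs \<and> set vs = pverts G"
    using finite_distinct_list[OF assms] by blast
  then have "distinct (vertex_list G) \<and> set (vertex_list G) = pverts G"
    unfolding vertex_list_def by (rule someI_ex)
  then show "distinct (vertex_list G)" and "set (vertex_list G) = pverts G" by auto
qed

lemma laplacian_matrix_similar:
  assumes xs: "distinct xs" and ys: "distinct ys" and eq: "set xs = set ys"
  shows "similar_mat (laplacian_matrix G xs) (laplacian_matrix G ys)"
proof -
  define n where "n = length xs"
  have ly: "length ys = n" unfolding n_def using xs ys eq by (metis distinct_card)
  define P where "P = mat n n (\<lambda>(i, j). if xs ! i = ys ! j then 1 else (0::real))"
  define Q where "Q = mat n n (\<lambda>(i, j). if ys ! i = xs ! j then 1 else (0::real))"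
  define l where "l a b = (if a = b then real (out_degree (with_proj G) a) else 0)
    - (if (a, b) \<in> parcs G then 1 else 0)" for a b
  have Lx: "laplacian_matrix G xs = mat n n (\<lambda>(i, j). l (xs ! i) (xs ! j))"
    using xs by (intro eq_matI)
      (auto simp: laplacian_matrix_def degree_matrix_def adjacency_matrix_def l_def n_def
        nth_eq_iff_index_eq)
  have Ly: "laplacian_matrix G ys = mat n n (\<lambda>(i, j). l (ys ! i) (ys ! j))"
    using ys by (intro eq_matI)
      (auto simp: laplacian_matrix_def degree_matrix_def adjacency_matrix_def l_def ly
        nth_eq_iff_index_eq)
  have sum_list: "(\<Sum>i<n. f (zs ! i)) = (\<Sum>a\<in>set zs. f a)"
    if "distinct zs" "length zs = n" for f :: "'a \<Rightarrow> real" and zs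
    using that by (intro sum.reindex_bij_betw bij_betw_nth) auto
  have sx: "(\<Sum>i<n. f (xs ! i)) = (\<Sum>a\<in>set xs. f a)" for f :: "'a \<Rightarrow> real"
    using sum_list[of xs f] xs n_def by simp
  have sy: "(\<Sum>i<n. f (ys ! i)) = (\<Sum>a\<in>set xs. f a)" for f :: "'a \<Rightarrow> real"
    using sum_list[of ys f] ys ly eq by simp
  have mx: "xs ! i \<in> set xs" "ys ! i \<in> set xs" if "i < n" for i
    using that ly unfolding n_def by (simp, simp add: eq)
  have ij: "xs ! i = xs ! j \<longleftrightarrow> i = j" "ys ! i = ys ! j \<longleftrightarrow> i = j" if "i < n" "j < n" for i j
    using that xs ys ly unfolding n_def by (simp_all add: nth_eq_iff_index_eq)
  have mm: "mat n n (\<lambda>(i, j). f (us ! i) (vs ! j)) * mat n n (\<lambda>(i, j). g (vs ! i) (ws ! j))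
      = mat n n (\<lambda>(i, j). \<Sum>a\<in>set xs. f (us ! i) a * g a (ws ! j))"
    if "vs = xs \<or> vs = ys" for f g :: "'a \<Rightarrow> 'a \<Rightarrow> real" and us vs ws
  proof -
    have "(\<Sum>m<n. h (vs ! m)) = (\<Sum>a\<in>set xs. h a)" for h :: "'a \<Rightarrow> real"
      using that sx sy by auto
    from this[of "\<lambda>a. f _ a * g a _"] show ?thesis
      by (intro eq_matI) (auto simp: scalar_prod_def atLeast0LessThan)
  qed
  have one: "(\<Sum>a\<in>set xs. (if p = a then 1 else 0) * f a) = f p"
    "(\<Sum>a\<in>set xs. f a * (if a = p then 1 else 0)) = f p"
    if "p \<in> set xs" for p and f :: "'a \<Rightarrow> real"
    using that by (auto simp: if_distrib if_distribR cong: if_cong)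
  let ?e = "\<lambda>a b. if a = b then 1 else (0::real)"
  have PQ: "P * Q = 1\<^sub>m n"
    unfolding P_def Q_def using mm[of ys ?e xs ?e xs]
    by (intro eq_matI) (auto simp: one mx ij)
  have QP: "Q * P = 1\<^sub>m n"
    unfolding P_def Q_def using mm[of xs ?e ys ?e ys]
    by (intro eq_matI) (auto simp: one mx ij)
  have PL: "P * laplacian_matrix G ys = mat n n (\<lambda>(i, j). l (xs ! i) (ys ! j))"
    unfolding P_def Ly using mm[of ys ?e xs l ys]
    by (intro eq_matI) (auto simp: one mx)
  have "P * laplacian_matrix G ys * Q = laplacian_matrix G xs"
    unfolding PL Q_def Lx using mm[of ys l xs ?e xs]
    by (intro eq_matI) (auto simp: one mx)
  then have "similar_mat_wit (laplacian_matrix G xs) (laplacian_matrix G ys) P Q"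
    using PQ QP by (intro similar_mat_witI[of _ _ n]) (auto simp: Lx Ly P_def Q_def)
  then show ?thesis unfolding similar_mat_def by blast
qed

lemma laplacian_spectrum_eq:
  assumes "distinct vs" and "set vs = pverts G"
  shows "laplacian_spectrum G = proots (char_poly (laplacian_matrix G vs))"
proof -
  have "finite (pverts G)" using assms(2) by (metis List.finite_set)
  then have "similar_mat (laplacian_matrix G (vertex_list G)) (laplacian_matrix G vs)"
    using assms vertex_list[of G] by (intro laplacian_matrix_similar) auto
  then show ?thesis unfolding laplacian_spectrum_def by (simp add: char_poly_similar)
qed

end

theory Submission
  imports Defs "HOL-Analysis.Function_Topology"
begin

text \<open>
  The algebraic connectivity is the minimum of the Rayleigh quotient over the functions of sum
  zero, so it can only grow when edges are added, and adding \<open>uv\<close> to \<open>G\<close> adds edges to the token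
  graph. If \<open>f\<close> is a sum-zero eigenfunction of a graph \<open>H\<close>, then \<open>A \<mapsto> (\<Sum>a\<in>A. f a)\<close> is a sum-zero
  eigenfunction of \<open>F\<^sub>k(H)\<close> with the same eigenvalue, so \<open>\<alpha>(F\<^sub>k(H)) \<le> \<alpha>(H)\<close>. Hence
  \<open>\<alpha>(G) = \<alpha>(F\<^sub>k(G)) \<le> \<alpha>(F\<^sub>k(G + uv)) \<le> \<alpha>(G + uv) = \<alpha>(G)\<close>.
\<close>

section \<open>The Laplacian as an operator on functions\<close>

text \<open>The Laplacian matrix as an operator that needs no enumeration of the vertices;
  \<open>laplacian_matrix_row\<close> links the two.\<close>

definition laplacian :: "'a pair_pre_digraph \<Rightarrow> ('a \<Rightarrow> real) \<Rightarrow> 'a \<Rightarrow> real" where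
  "laplacian G f a = (\<Sum>b | (a, b) \<in> parcs G. f a - f b)"

text \<open>The factor 1/2 compensates for \<open>parcs\<close> holding both orientations of each
  edge. The form is kept bilinear so that first variations can be expressed.\<close>

definition dirichlet_form :: "'a pair_pre_digraph \<Rightarrow> ('a \<Rightarrow> real) \<Rightarrow> ('a \<Rightarrow> real) \<Rightarrow> real" where
  "dirichlet_form G f g = (\<Sum>(a, b)\<in>parcs G. (f a - f b) * (g a - g b)) / 2"

lemma (in pair_graph) parcs_sym: "(a, b) \<in> parcs G \<Longrightarrow> (b, a) \<in> parcs G"
  using pair_sym_arcs by (auto simp: symmetric_def sym_def)

lemma (in pair_graph) finite_neighbours: "finite {b. (a, b) \<in> parcs G}"
  by (rule finite_subset[OF _ pair_finite_verts]) (auto dest: in_arcsD2)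

lemma (in pair_graph) sum_parcs_swap:
  "(\<Sum>(a, b)\<in>parcs G. h b a) = (\<Sum>(a, b)\<in>parcs G. h a (b :: 'a) :: real)"
  by (rule sum.reindex_bij_witness[of _ prod.swap prod.swap]) (auto intro: parcs_sym)

text \<open>Summation by parts: reversing all arcs leaves the sum unchanged, and averaging the two
  versions gives the symmetric form.\<close>

lemma (in pair_graph) sum_mult_laplacian:
  "(\<Sum>a\<in>pverts G. g a * laplacian G f a) = dirichlet_form G f g"
proof -
  have "(\<Sum>a\<in>pverts G. g a * laplacian G f a)
      = (\<Sum>a\<in>pverts G. \<Sum>b | (a, b) \<in> parcs G. g a * (f a - f b))"
    by (simp add: laplacian_def sum_distrib_left)
  also have "\<dots> = (\<Sum>(a, b)\<in>(SIGMA a:pverts G. {b. (a, b) \<in> parcs G}). g a * (f a - f b))"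
    by (intro sum.Sigma pair_finite_verts ballI finite_neighbours)
  also have "(SIGMA a:pverts G. {b. (a, b) \<in> parcs G}) = parcs G"
    by (auto dest: in_arcsD1)
  finally have 1: "(\<Sum>a\<in>pverts G. g a * laplacian G f a)
      = (\<Sum>(a, b)\<in>parcs G. g a * (f a - f b))" .
  have 2: "(\<Sum>(a, b)\<in>parcs G. g a * (f a - f b)) = (\<Sum>(a, b)\<in>parcs G. g b * (f b - f a))"
    using sum_parcs_swap[of "\<lambda>b a. g a * (f a - f b)"] .
  have "(\<Sum>(a, b)\<in>parcs G. g a * (f a - f b)) + (\<Sum>(a, b)\<in>parcs G. g b * (f b - f a))
      = (\<Sum>(a, b)\<in>parcs G. (f a - f b) * (g a - g b))"
    unfolding sum.distrib[symmetric] by (intro sum.cong) (auto simp: algebra_simps)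
  with 1 2 show ?thesis by (simp add: dirichlet_form_def)
qed

lemma (in pair_graph) sum_laplacian: "(\<Sum>a\<in>pverts G. laplacian G f a) = 0"
  using sum_mult_laplacian[of "\<lambda>_. 1" f] by (simp add: dirichlet_form_def)

lemma dirichlet_form_add_scale:
  "dirichlet_form G (\<lambda>a. f a + t * g a) (\<lambda>a. f a + t * g a)
     = dirichlet_form G f f + 2 * t * dirichlet_form G f g + t\<^sup>2 * dirichlet_form G g g"
proof -
  have "(\<Sum>(a, b)\<in>parcs G. ((f a + t * g a) - (f b + t * g b)) * ((f a + t * g a) - (f b + t * g b)))
    = (\<Sum>(a, b)\<in>parcs G. (f a - f b) * (f a - f b))
      + 2 * t * (\<Sum>(a, b)\<in>parcs G. (f a - f b) * (g a - g b))
      + t\<^sup>2 * (\<Sum>(a, b)\<in>parcs G. (g a - g b) * (g a - g b))"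
    unfolding sum_distrib_left sum.distrib[symmetric]
    by (intro sum.cong) (auto simp: algebra_simps power2_eq_square)
  then show ?thesis by (simp add: dirichlet_form_def)
qed

lemma dirichlet_form_nonneg: "0 \<le> dirichlet_form G f f"
  by (auto simp: dirichlet_form_def intro!: sum_nonneg)

lemma dirichlet_form_mono:
  assumes "finite (parcs H)" "parcs G \<subseteq> parcs H"
  shows "dirichlet_form G f f \<le> dirichlet_form H f f"
  unfolding dirichlet_form_def using assms by (intro divide_right_mono sum_mono2) auto

lemma (in pair_graph) rayleigh_eigenfunction:
  assumes f: "\<And>a. a \<in> pverts G \<Longrightarrow> laplacian G f a = e * f a"
  shows "dirichlet_form G f f = e * (\<Sum>a\<in>pverts G. (f a)\<^sup>2)"
  unfolding sum_mult_laplacian[symmetric] sum_distrib_left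
  by (intro sum.cong) (auto simp: f power2_eq_square)

section \<open>The minimal Rayleigh quotient on mean-zero functions\<close>

text \<open>Near 0 the linear term dominates, and it changes sign with \<open>t\<close> unless its
  coefficient vanishes.\<close>

lemma quadratic_nonneg_linear_coeff_zero:
  fixes b c :: real
  assumes "\<And>t. 0 \<le> 2 * t * b + t\<^sup>2 * c"
  shows "b = 0"
proof (rule ccontr)
  assume b: "b \<noteq> 0"
  \<comment> \<open>With \<open>s\<close> positive and above \<open>c\<close>, the choice
    \<open>t = - b / s\<close> is small enough for the linear term to win.\<close>
  define s where "s = \<bar>c\<bar> + 1"
  have s: "s > 0" "c < s" by (auto simp: s_def)
  have "2 * (- b / s) * b + (- b / s)\<^sup>2 * c = b\<^sup>2 / s * (c / s - 2)"
    using s by (simp add: field_simps power2_eq_square)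
  moreover have "c / s < 2" using s by (simp add: field_simps)
  then have "b\<^sup>2 / s * (c / s - 2) < 0"
    using s b by (intro mult_pos_neg) auto
  ultimately show False using assms[of "- b / s"] by linarith
qed

text \<open>The type \<open>'a\<close> may be infinite, so functions are pinned to 0 off
  \<open>V\<close>. The set is then closed in a product of compact intervals, and Tychonoff's
  theorem applies.\<close>

lemma compact_mean_zero_sphere:
  fixes V :: "'a set"
  assumes "finite V"
  shows "compact {f :: 'a \<Rightarrow> real. (\<forall>a. a \<notin> V \<longrightarrow> f a = 0) \<and> (\<Sum>a\<in>V. f a) = 0 \<and> (\<Sum>a\<in>V. (f a)\<^sup>2) = 1}"
    (is "compact ?K")
proof -
  let ?B = "\<lambda>a. if a \<in> V then {-1..1} else {0 :: real}"
  have "compactin (product_topology (\<lambda>_. euclidean) UNIV) (PiE UNIV ?B)"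
    unfolding compactin_PiE by auto
  then have B: "compact (PiE UNIV ?B)"
    by (simp add: euclidean_product_topology)
  have coord: "continuous_on UNIV (\<lambda>f :: 'a \<Rightarrow> real. f a)" for a
    by simp
  have "closed {f :: 'a \<Rightarrow> real. (\<Sum>a\<in>V. f a) = 0}" "closed {f :: 'a \<Rightarrow> real. (\<Sum>a\<in>V. (f a)\<^sup>2) = 1}"
    by (intro closed_Collect_eq continuous_intros coord)+
  with B have "compact (PiE UNIV ?B \<inter> ({f. (\<Sum>a\<in>V. f a) = 0} \<inter> {f. (\<Sum>a\<in>V. (f a)\<^sup>2) = 1}))"
    by (intro compact_Int_closed closed_Int)
  also have "PiE UNIV ?B \<inter> ({f. (\<Sum>a\<in>V. f a) = 0} \<inter> {f. (\<Sum>a\<in>V. (f a)\<^sup>2) = 1}) = ?K"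
  proof -
    \<comment> \<open>The unit norm already bounds every coordinate, so the box on \<open>V\<close>
      is no further restriction.\<close>
    have "f a \<in> {-1..1}" if "(\<Sum>a\<in>V. (f a)\<^sup>2) = 1" "a \<in> V" for f :: "'a \<Rightarrow> real" and a
    proof -
      have "(f a)\<^sup>2 \<le> (\<Sum>a\<in>V. (f a)\<^sup>2)"
        using that assms by (intro member_le_sum) auto
      then have "\<bar>f a\<bar> \<le> 1" using that by (simp add: abs_square_le_1)
      then show ?thesis by auto
    qed
    then show ?thesis by (fastforce simp: PiE_iff split: if_splits)
  qed
  finally show ?thesis .
qed

text \<open>The Dirichlet form attains a minimum \<open>e\<close> on the compact sphere. Homogeneity
  extends the bound to all mean-zero functions, and the vanishing first variation at the minimiser
  is the eigenvalue equation.\<close>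

lemma (in pair_graph) exists_rayleigh_minimiser:
  assumes card: "2 \<le> card (pverts G)"
  obtains f e where "(\<Sum>a\<in>pverts G. f a) = 0" "(\<Sum>a\<in>pverts G. (f a)\<^sup>2) > 0"
    "\<And>a. a \<in> pverts G \<Longrightarrow> laplacian G f a = e * f a"
    "\<And>g. (\<Sum>a\<in>pverts G. g a) = 0 \<Longrightarrow> e * (\<Sum>a\<in>pverts G. (g a)\<^sup>2) \<le> dirichlet_form G g g"
proof -
  let ?V = "pverts G"
  let ?K = "{f. (\<forall>a. a \<notin> ?V \<longrightarrow> f a = 0) \<and> (\<Sum>a\<in>?V. f a) = 0 \<and> (\<Sum>a\<in>?V. (f a)\<^sup>2) = (1::real)}"
  have normalise: "(\<lambda>a. if a \<in> ?V then g a / sqrt (\<Sum>a\<in>?V. (g a)\<^sup>2) else 0) \<in> ?K"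
    if "(\<Sum>a\<in>?V. g a) = 0" "(\<Sum>a\<in>?V. (g a)\<^sup>2) > 0" for g
  proof -
    define r where "r = sqrt (\<Sum>a\<in>?V. (g a)\<^sup>2)"
    have r: "r > 0" "r\<^sup>2 = (\<Sum>a\<in>?V. (g a)\<^sup>2)" using that(2) by (auto simp: r_def)
    have "(\<Sum>a\<in>?V. if a \<in> ?V then g a / r else 0) = (\<Sum>a\<in>?V. g a) / r"
      unfolding sum_divide_distrib by (intro sum.cong) auto
    moreover have "(\<Sum>a\<in>?V. (if a \<in> ?V then g a / r else 0)\<^sup>2) = (\<Sum>a\<in>?V. (g a)\<^sup>2) / r\<^sup>2"
      unfolding sum_divide_distrib by (intro sum.cong) (auto simp: power_divide)
    ultimately show ?thesis using that r unfolding r_def[symmetric] by auto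
  qed
  obtain p q where pq: "p \<in> ?V" "q \<in> ?V" "p \<noteq> q"
    using card by (metis card_le_Suc0_iff_eq not_less_eq_eq numeral_2_eq_2 pair_finite_verts)
  have ne: "?K \<noteq> {}"
  proof -
    \<comment> \<open>The difference of the indicators of two vertices is mean-zero and nonzero, so
      the sphere is inhabited.\<close>
    define g where "g a = (if a = p then 1 else if a = q then -1 else (0::real))" for a
    have V: "?V = insert p (insert q (?V - {p, q}))" using pq by auto
    have g: "(\<Sum>a\<in>?V. g a) = 0" "(\<Sum>a\<in>?V. (g a)\<^sup>2) = 2"
      using pq pair_finite_verts by (subst V, subst sum.insert, auto simp: g_def)+
    then have "(\<Sum>a\<in>?V. (g a)\<^sup>2) > 0" by simp
    from normalise[OF g(1) this] show ?thesis by (rule ex_in_conv[THEN iffD1, OF exI])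
  qed
  have cont: "continuous_on ?K (\<lambda>f. dirichlet_form G f f)"
  proof -
    have coord: "continuous_on ?K (\<lambda>f. f a)" for a
      by (rule continuous_on_subset[OF continuous_on_product_coordinates]) auto
    show ?thesis unfolding dirichlet_form_def case_prod_unfold
      by (intro continuous_intros coord) auto
  qed
  obtain f where f: "f \<in> ?K"
    and min: "\<forall>g\<in>?K. dirichlet_form G f f \<le> dirichlet_form G g g"
    using continuous_attains_inf[OF compact_mean_zero_sphere[OF pair_finite_verts] ne cont]
    by (rule bexE)
  define e where "e = dirichlet_form G f f"
  have low: "e * (\<Sum>a\<in>?V. (g a)\<^sup>2) \<le> dirichlet_form G g g" if g: "(\<Sum>a\<in>?V. g a) = 0" for g
  proof (cases "(\<Sum>a\<in>?V. (g a)\<^sup>2) > 0")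
    case True
    define r where "r = sqrt (\<Sum>a\<in>?V. (g a)\<^sup>2)"
    have r: "r > 0" "r\<^sup>2 = (\<Sum>a\<in>?V. (g a)\<^sup>2)" using True by (auto simp: r_def)
    let ?g = "\<lambda>a. if a \<in> ?V then g a / r else 0"
    have "dirichlet_form G ?g ?g = dirichlet_form G g g / r\<^sup>2"
    proof -
      have "(\<Sum>(a, b)\<in>parcs G. (?g a - ?g b) * (?g a - ?g b))
          = (\<Sum>(a, b)\<in>parcs G. (g a - g b) * (g a - g b)) / r\<^sup>2"
        unfolding sum_divide_distrib using r(1)
        by (intro sum.cong)
          (auto dest: in_arcsD1 in_arcsD2 simp: field_simps power2_eq_square)
      then show ?thesis by (simp add: dirichlet_form_def)
    qed
    moreover have "e \<le> dirichlet_form G ?g ?g"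
      using bspec[OF min normalise[OF g True]] unfolding r_def[symmetric] e_def[symmetric] .
    ultimately show ?thesis using r(1) by (simp add: pos_le_divide_eq flip: r(2))
  next
    case False
    moreover have "(\<Sum>a\<in>?V. (g a)\<^sup>2) \<ge> 0" by (intro sum_nonneg) auto
    ultimately have "(\<Sum>a\<in>?V. (g a)\<^sup>2) = 0" by simp
    then show ?thesis using dirichlet_form_nonneg[of G g] by simp
  qed
  have f0: "(\<Sum>a\<in>?V. f a) = 0" and f1: "(\<Sum>a\<in>?V. (f a)\<^sup>2) = 1" using f by auto
  \<comment> \<open>\<open>h\<close> is the gradient of the Rayleigh quotient at \<open>f\<close>; minimality in its own direction kills it.\<close>
  define h where "h a = laplacian G f a - e * f a" for a
  \<comment> \<open>Mean zero makes every perturbation \<open>f + t * h\<close> admissible in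
    \<open>low\<close>.\<close>
  have h0: "(\<Sum>a\<in>?V. h a) = 0"
    by (simp add: h_def sum_subtractf sum_laplacian f0 flip: sum_distrib_left)
  let ?ip = "\<Sum>a\<in>?V. f a * h a"
  \<comment> \<open>In the bound for \<open>f + t * h\<close> the constant terms cancel, because
    \<open>f\<close> has norm 1 and energy \<open>e\<close>; a quadratic in \<open>t\<close> without
    constant term remains.\<close>
  have "dirichlet_form G f h - e * ?ip = 0"
  proof (rule quadratic_nonneg_linear_coeff_zero)
    fix t :: real
    have sum0: "(\<Sum>a\<in>?V. f a + t * h a) = 0"
      by (simp add: sum.distrib f0 h0 flip: sum_distrib_left)
    have sq: "(\<Sum>a\<in>?V. (f a + t * h a)\<^sup>2) = 1 + 2 * t * ?ip + t\<^sup>2 * (\<Sum>a\<in>?V. (h a)\<^sup>2)"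
      unfolding f1[symmetric] sum_distrib_left sum.distrib[symmetric]
      by (intro sum.cong) (auto simp: algebra_simps power2_eq_square)
    show "0 \<le> 2 * t * (dirichlet_form G f h - e * ?ip)
        + t\<^sup>2 * (dirichlet_form G h h - e * (\<Sum>a\<in>?V. (h a)\<^sup>2))"
      using low[OF sum0] unfolding sq dirichlet_form_add_scale e_def[symmetric]
      by (simp add: algebra_simps)
  qed
  moreover have "dirichlet_form G f h - e * ?ip = (\<Sum>a\<in>?V. (h a)\<^sup>2)"
    unfolding sum_mult_laplacian[symmetric] sum_distrib_left sum_subtractf[symmetric]
    by (intro sum.cong) (auto simp: h_def algebra_simps power2_eq_square)
  ultimately have "(\<Sum>a\<in>?V. (h a)\<^sup>2) = 0" by simp
  then have "\<forall>a\<in>?V. h a = 0"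
    by (subst (asm) sum_nonneg_eq_0_iff) (auto simp: pair_finite_verts)
  then show ?thesis using that[of f e] f0 f1 low by (auto simp: h_def)
qed

section \<open>Deflating the constant functions\<close>

text \<open>Conjugate by the basis consisting of the all-ones vector and all but the first unit vector.\<close>

lemma char_poly_zero_row_sums:
  fixes L :: "'b :: field mat"
  assumes L: "L \<in> carrier_mat (Suc m) (Suc m)"
    and rows: "\<And>i. i < Suc m \<Longrightarrow> (\<Sum>j<Suc m. L $$ (i, j)) = 0"
  shows "char_poly L
       = [:0, 1:] * char_poly (mat m m (\<lambda>(i, j). L $$ (Suc i, Suc j) - L $$ (0, Suc j)))"
proof -
  define n where "n = Suc m"
  define M where "M = mat m m (\<lambda>(i, j). L $$ (Suc i, Suc j) - L $$ (0, Suc j))"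
  define R where "R = mat 1 m (\<lambda>(i, j). L $$ (0, Suc j))"
  define B where "B = four_block_mat (0\<^sub>m 1 1) R (0\<^sub>m m 1) M"
  define P where "P = mat n n (\<lambda>(i, j). if j = 0 \<or> i = j then 1 else (0::'b))"
  define Q where "Q = mat n n (\<lambda>(i, j). if i = j then 1 else if j = 0 then -1 else (0::'b))"
  have carr: "L \<in> carrier_mat n n" "B \<in> carrier_mat n n" "P \<in> carrier_mat n n"
    "Q \<in> carrier_mat n n"
    using L by (auto simp: n_def B_def M_def R_def P_def Q_def)
  have B: "B $$ (i, j) = (if j = 0 then 0 else if i = 0 then L $$ (0, j)
      else L $$ (i, j) - L $$ (0, j))" if "i < n" "j < n" for i j
    using that by (auto simp: B_def M_def R_def n_def)
  have P_left: "(P * X) $$ (i, j) = (if i = 0 then X $$ (0, j) else X $$ (0, j) + X $$ (i, j))"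
    if "X \<in> carrier_mat n n" "i < n" "j < n" for X i j
  proof -
    have "(P * X) $$ (i, j) = (\<Sum>k\<in>{0..<n}. (if k = 0 \<or> i = k then 1 else 0) * X $$ (k, j))"
      using that by (auto simp: P_def scalar_prod_def intro!: sum.cong)
    also have "\<dots> = (\<Sum>k\<in>{0, i}. X $$ (k, j))"
      using that by (intro sum.mono_neutral_cong_right) auto
    finally show ?thesis by simp
  qed
  have P_right: "(X * P) $$ (i, j) = (if j = 0 then (\<Sum>k<n. X $$ (i, k)) else X $$ (i, j))"
    if "X \<in> carrier_mat n n" "i < n" "j < n" for X i j
  proof -
    have "(X * P) $$ (i, j) = (\<Sum>k<n. X $$ (i, k) * (if j = 0 \<or> k = j then 1 else 0))"
      using that by (auto simp: P_def scalar_prod_def atLeast0LessThan intro!: sum.cong)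
    then show ?thesis using that by (auto simp: if_distrib cong: if_cong)
  qed
  have PQ: "P * Q = 1\<^sub>m n"
  proof (rule eq_matI)
    fix i j assume "i < dim_row (1\<^sub>m n :: 'b mat)" "j < dim_col (1\<^sub>m n :: 'b mat)"
    then have ij: "i < n" "j < n" "0 < n" by auto
    show "(P * Q) $$ (i, j) = 1\<^sub>m n $$ (i, j)"
      unfolding P_left[OF carr(4) ij(1,2)] using ij by (simp add: Q_def)
  qed (use carr in auto)
  then have QP: "Q * P = 1\<^sub>m n"
    using mat_mult_left_right_inverse[OF carr(3,4)] by simp
  \<comment> \<open>Zero row sums annihilate column 0 of \<open>L * P\<close>. In
    \<open>P * B\<close> the first row of \<open>B\<close> is added back to every later row, undoing
    the subtraction in \<open>M\<close>.\<close>
  have LP: "L * P = P * B"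
  proof (rule eq_matI)
    fix i j assume "i < dim_row (P * B)" "j < dim_col (P * B)"
    then have ij: "i < n" "j < n" "0 < n" using carr by auto
    show "(L * P) $$ (i, j) = (P * B) $$ (i, j)"
      unfolding P_left[OF carr(2) ij(1,2)] P_right[OF carr(1) ij(1,2)]
      using ij rows by (simp add: B n_def)
  qed (use carr in auto)
  have "L = L * P * Q"
    using carr PQ by (simp add: assoc_mult_mat[of L n n P n Q n])
  then have "similar_mat_wit L B P Q"
    using PQ QP LP carr by (intro similar_mat_witI[of _ _ n]) auto
  then have "char_poly L = char_poly B"
    by (intro char_poly_similar) (auto simp: similar_mat_def)
  also have "\<dots> = char_poly (0\<^sub>m 1 1) * char_poly M"
    unfolding B_def by (rule char_poly_four_block_zeros_col) (auto simp: R_def M_def)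
  also have "char_poly (0\<^sub>m 1 1 :: 'b mat) = [:0, 1:]"
    by (simp add: char_poly_def char_poly_matrix_def det_single)
  finally show ?thesis unfolding M_def .
qed

text \<open>The diagonal contributes the degree times the value at the vertex, and the adjacency
  part subtracts the values at its neighbours.\<close>

lemma (in pair_graph) laplacian_matrix_row:
  assumes vs: "distinct vs" "set vs = pverts G" and i: "i < length vs"
  shows "(\<Sum>j<length vs. laplacian_matrix G vs $$ (i, j) * f (vs ! j)) = laplacian G f (vs ! i)"
proof -
  let ?a = "vs ! i"
  let ?N = "{b. (?a, b) \<in> parcs G}"
  have deg: "out_degree (with_proj G) ?a = card ?N"
  proof -
    have "out_arcs (with_proj G) ?a = Pair ?a ` ?N" by (auto simp: out_arcs_def)
    then show ?thesis by (simp add: out_degree_def card_image inj_on_def)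
  qed
  have N: "?N \<subseteq> pverts G" by (auto dest: in_arcsD2)
  have "(\<Sum>j<length vs. laplacian_matrix G vs $$ (i, j) * f (vs ! j))
      = (\<Sum>j<length vs. ((if ?a = vs ! j then real (card ?N) else 0)
          - (if vs ! j \<in> ?N then 1 else 0)) * f (vs ! j))"
    using i vs by (intro sum.cong)
      (auto simp: laplacian_matrix_def degree_matrix_def adjacency_matrix_def deg
        nth_eq_iff_index_eq)
  also have "\<dots> = (\<Sum>b\<in>pverts G. ((if ?a = b then real (card ?N) else 0)
          - (if b \<in> ?N then 1 else 0)) * f b)"
    using vs by (intro sum.reindex_bij_betw bij_betw_nth) auto
  also have "\<dots> = (\<Sum>b\<in>pverts G. if ?a = b then real (card ?N) * f b else 0)
          - (\<Sum>b\<in>pverts G. if b \<in> ?N then f b else 0)"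
    unfolding sum_subtractf[symmetric] by (intro sum.cong) (auto simp: algebra_simps)
  also have "(\<Sum>b\<in>pverts G. if ?a = b then real (card ?N) * f b else 0) = real (card ?N) * f ?a"
    using i vs by (simp add: pair_finite_verts flip: vs(2))
  also have "(\<Sum>b\<in>pverts G. if b \<in> ?N then f b else 0) = (\<Sum>b\<in>?N. f b)"
    using N pair_finite_verts by (intro sum.mono_neutral_cong_right) auto
  finally show ?thesis by (simp add: laplacian_def sum_subtractf)
qed

lemma laplacian_shift: "laplacian G (\<lambda>a. f a + c) = laplacian G f"
  by (simp add: laplacian_def fun_eq_iff)

text \<open>\<open>M\<close> is the Laplacian on functions modulo constants. Each class has one
  representative vanishing at \<open>p\<close>, on which \<open>M\<close> acts in coordinates, and
  one of mean zero; the proof passes between them by adding constants.\<close>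

lemma (in pair_graph) deflated_laplacian_root_iff:
  assumes vs: "distinct (p # ws)" "set (p # ws) = pverts G"
  defines "L \<equiv> laplacian_matrix G (p # ws)"
  defines "M \<equiv> mat (length ws) (length ws) (\<lambda>(i, j). L $$ (Suc i, Suc j) - L $$ (0, Suc j))"
  shows "poly (char_poly M) e = 0 \<longleftrightarrow>
    (\<exists>f. (\<Sum>a\<in>pverts G. f a) = 0 \<and> (\<exists>a\<in>pverts G. f a \<noteq> 0) \<and>
      (\<forall>a\<in>pverts G. laplacian G f a = e * f a))" (is "_ \<longleftrightarrow> ?R")
proof -
  define m where "m = length ws"
  have M: "M \<in> carrier_mat m m" by (simp add: M_def m_def)
  have Mv: "(M *\<^sub>v w) $ i = laplacian G f (ws ! i) - laplacian G f p"
    if w: "w = vec m (\<lambda>i. f (ws ! i))" and i: "i < m" and fp: "f p = 0" for f w i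
  proof -
    have row: "(\<Sum>j<m. L $$ (k, Suc j) * f (ws ! j)) = laplacian G f ((p # ws) ! k)" if "k < Suc m" for k
      using laplacian_matrix_row[OF vs, of k f] that fp
      by (simp add: L_def m_def sum.lessThan_Suc_shift del: sum.lessThan_Suc)
    have "(M *\<^sub>v w) $ i = (\<Sum>j<m. (L $$ (Suc i, Suc j) - L $$ (0, Suc j)) * f (ws ! j))"
      using i M unfolding w by (auto simp: M_def m_def scalar_prod_def atLeast0LessThan)
    also have "\<dots> = laplacian G f (ws ! i) - laplacian G f p"
      using row[of "Suc i"] row[of 0] i
      by (simp add: left_diff_distrib sum_subtractf)
    finally show ?thesis .
  qed
  have V: "pverts G = insert p (set ws)" "p \<notin> set ws" "distinct ws" using vs by auto
  have "?R" if "eigenvector M w e" for w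
  proof -
    from that M have w: "w \<in> carrier_vec m" "w \<noteq> 0\<^sub>v m" "M *\<^sub>v w = e \<cdot>\<^sub>v w"
      by (auto simp: eigenvector_def)
    \<comment> \<open>\<open>f\<close> is the function vanishing at \<open>p\<close> whose values
      along \<open>ws\<close> are the coordinates of \<open>w\<close>.\<close>
    define f where "f a = (if a = p then 0 else w $ (THE i. i < m \<and> ws ! i = a))" for a
    have fp: "f p = 0" by (simp add: f_def)
    have fw: "f (ws ! i) = w $ i" if "i < m" for i
    proof -
      have "(THE j. j < m \<and> ws ! j = ws ! i) = i"
        using that V(3) by (intro the_equality) (auto simp: m_def nth_eq_iff_index_eq)
      moreover have "ws ! i \<noteq> p" using that V(2) by (auto simp: m_def)
      ultimately show ?thesis by (simp add: f_def)
    qed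
    have "w = vec m (\<lambda>i. f (ws ! i))" using w fw by (intro eq_vecI) auto
    note Mf = Mv[OF this _ fp]
    \<comment> \<open>An eigenvector of \<open>M\<close> solves the eigenvalue equation only up to
      this constant.\<close>
    define c where "c = laplacian G f p"
    have lap: "laplacian G f a = e * f a + c" if a: "a \<in> pverts G" for a
    proof (cases "a = p")
      case False
      then obtain i where i: "i < m" "a = ws ! i"
        using a V(1) by (auto simp: in_set_conv_nth m_def)
      then show ?thesis using Mf[of i] w fw[of i] by (simp add: c_def)
    qed (simp add: fp c_def)
    let ?n = "real (card (pverts G))"
    have n: "?n > 0" using V(1) pair_finite_verts by (simp add: card_gt_0_iff)
    define s where "s = (\<Sum>a\<in>pverts G. f a) / ?n"
    define g where "g a = f a + (- s)" for a
    have "(\<Sum>a\<in>pverts G. laplacian G f a) = e * (\<Sum>a\<in>pverts G. f a) + ?n * c"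
      using lap by (simp add: sum.distrib sum_distrib_left)
    \<comment> \<open>Since the Laplacian sums to zero, \<open>c\<close> is determined by the mean
      \<open>s\<close>, and subtracting \<open>s\<close> from \<open>f\<close> absorbs it.\<close>
    then have "?n * (e * s + c) = 0"
      using n by (simp add: sum_laplacian s_def field_simps)
    then have c: "c = - e * s" using n by auto
    have "laplacian G g a = e * g a" if "a \<in> pverts G" for a
      using lap[OF that] unfolding g_def laplacian_shift by (simp add: c algebra_simps)
    moreover have "(\<Sum>a\<in>pverts G. g a) = 0"
      using n by (simp add: g_def sum_subtractf s_def)
    moreover have "\<exists>a\<in>pverts G. g a \<noteq> 0"
    proof (rule ccontr)
      assume "\<not> ?thesis"
      then have *: "f a = s" if "a \<in> pverts G" for a using that by (auto simp: g_def)
      then have "s = 0" using fp V(1) by auto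
      then have "w $ i = 0" if "i < m" for i
        using *[of "ws ! i"] fw[OF that] that V(1) by (auto simp: m_def)
      then have "w = 0\<^sub>v m" using w by (intro eq_vecI) auto
      with w show False by simp
    qed
    ultimately show ?R by blast
  qed
  moreover have "eigenvalue M e" if R: ?R
  proof -
    from R obtain f where f: "(\<Sum>a\<in>pverts G. f a) = 0" "\<exists>a\<in>pverts G. f a \<noteq> 0"
      and lap: "\<And>a. a \<in> pverts G \<Longrightarrow> laplacian G f a = e * f a" by blast
    \<comment> \<open>The representative of \<open>f\<close> modulo constants that vanishes at
      \<open>p\<close>.\<close>
    define g where "g a = f a + (- f p)" for a
    have gp: "g p = 0" by (simp add: g_def)
    define w where "w = vec m (\<lambda>i. g (ws ! i))"
    have "M *\<^sub>v w = e \<cdot>\<^sub>v w"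
    proof (rule eq_vecI)
      fix i assume "i < dim_vec (e \<cdot>\<^sub>v w)"
      then have i: "i < m" by (simp add: w_def)
      then have "ws ! i \<in> pverts G" "p \<in> pverts G" using V(1) by (auto simp: m_def)
      then show "(M *\<^sub>v w) $ i = (e \<cdot>\<^sub>v w) $ i"
        unfolding Mv[OF w_def i gp] using i
        by (simp add: w_def g_def[abs_def] laplacian_shift lap algebra_simps
            del: add_uminus_conv_diff)
    qed (use M in \<open>auto simp: w_def\<close>)
    moreover have "w \<noteq> 0\<^sub>v m"
    proof
      assume w0: "w = 0\<^sub>v m"
      have "g (ws ! i) = 0" if "i < m" for i
        using arg_cong[OF w0, of "\<lambda>v. v $ i"] that by (simp add: w_def)
      then have const: "f a = f p" if "a \<in> pverts G" for a
        using that V(1) by (auto simp: in_set_conv_nth m_def g_def)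
      then have "(\<Sum>a\<in>pverts G. f a) = real (card (pverts G)) * f p" by simp
      then have "f p = 0" using f(1) V(1) pair_finite_verts by auto
      with const f(2) show False by auto
    qed
    ultimately show ?thesis using M
      by (auto simp: eigenvalue_def eigenvector_def w_def intro!: exI[of _ w])
  qed
  ultimately show ?thesis
    unfolding eigenvalue_root_char_poly[OF M, symmetric] by (auto simp: eigenvalue_def)
qed

section \<open>The algebraic connectivity as a minimal Rayleigh quotient\<close>

text \<open>To be applied with \<open>z = 0\<close>, the eigenvalue of the constants, and
  \<open>S\<close> the remaining spectrum. The case \<open>y = z\<close> is included, which covers a
  multiple eigenvalue 0.\<close>

lemma sorted_list_of_add_mset_nth_1:
  fixes S :: "'b :: linorder multiset"
  assumes "\<And>x. x \<in># S \<Longrightarrow> z \<le> y \<and> y \<le> x" and "y \<in># S"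
  shows "sorted_list_of_multiset (add_mset z S) ! 1 = y"
proof -
  define xs where "xs = sorted_list_of_multiset S"
  have xs: "sorted xs" "set xs = set_mset S"
    by (auto simp: xs_def)
  have "sorted_list_of_multiset (add_mset z S) = z # xs"
    using assms(1) xs by (subst sorted_list_of_multiset_insert, fold xs_def)
      (intro insort_is_Cons, force)
  moreover from assms(2) xs obtain x ys where "xs = x # ys" by (cases xs) auto
  moreover from this xs assms have "x = y" by (metis antisym list.set_intros(1) set_ConsD sorted_simps(2))
  ultimately show ?thesis by simp
qed

text \<open>Courant-Fischer for the second eigenvalue: splitting off one eigenvalue 0 leaves exactly
  the eigenvalues with mean-zero eigenfunctions, the least of which is the minimal Rayleigh
  quotient.\<close>

lemma (in pair_graph) algebraic_connectivity_rayleigh: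
  assumes card: "2 \<le> card (pverts G)"
  obtains f where "(\<Sum>a\<in>pverts G. f a) = 0" "(\<Sum>a\<in>pverts G. (f a)\<^sup>2) > 0"
    "\<And>a. a \<in> pverts G \<Longrightarrow> laplacian G f a = algebraic_connectivity G * f a"
    "\<And>g. (\<Sum>a\<in>pverts G. g a) = 0 \<Longrightarrow>
      algebraic_connectivity G * (\<Sum>a\<in>pverts G. (g a)\<^sup>2) \<le> dirichlet_form G g g"
proof -
  obtain f e where f: "(\<Sum>a\<in>pverts G. f a) = 0" "(\<Sum>a\<in>pverts G. (f a)\<^sup>2) > 0"
    and lap: "\<And>a. a \<in> pverts G \<Longrightarrow> laplacian G f a = e * f a"
    and low: "\<And>g. (\<Sum>a\<in>pverts G. g a) = 0 \<Longrightarrow>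
        e * (\<Sum>a\<in>pverts G. (g a)\<^sup>2) \<le> dirichlet_form G g g"
    using exists_rayleigh_minimiser[OF card] by metis
  obtain vs where "distinct vs" "set vs = pverts G"
    using finite_distinct_list[OF pair_finite_verts] by blast
  moreover from this card obtain p ws where "vs = p # ws" by (cases vs) auto
  ultimately have vs: "distinct (p # ws)" "set (p # ws) = pverts G" by auto
  define L where "L = laplacian_matrix G (p # ws)"
  define M where "M = mat (length ws) (length ws)
    (\<lambda>(i, j). L $$ (Suc i, Suc j) - L $$ (0, Suc j))"
  have "char_poly L = [:0, 1:] * char_poly M"
    unfolding M_def
  proof (rule char_poly_zero_row_sums)
    show "L \<in> carrier_mat (Suc (length ws)) (Suc (length ws))"
      by (auto simp: L_def laplacian_matrix_def degree_matrix_def adjacency_matrix_def)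
    show "(\<Sum>j<Suc (length ws). L $$ (i, j)) = 0" if "i < Suc (length ws)" for i
      using laplacian_matrix_row[OF vs, of i "\<lambda>_. 1"] that
      by (simp add: L_def laplacian_def)
  qed
  moreover have M0: "char_poly M \<noteq> 0"
    using degree_monic_char_poly[of M "length ws"] by (auto simp: M_def)
  ultimately have spec: "laplacian_spectrum G = add_mset 0 (proots (char_poly M))"
    using laplacian_spectrum_eq[OF vs] by (simp add: L_def proots_mult del: mult_pCons_left)
  have roots: "x \<in># proots (char_poly M) \<longleftrightarrow> (\<exists>f. (\<Sum>a\<in>pverts G. f a) = 0 \<and>
      (\<exists>a\<in>pverts G. f a \<noteq> 0) \<and> (\<forall>a\<in>pverts G. laplacian G f a = x * f a))" for x
    using M0 deflated_laplacian_root_iff[OF vs, of x] by (simp add: M_def L_def)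
  have "0 \<le> e"
    using rayleigh_eigenfunction[OF lap] dirichlet_form_nonneg[of G f] f(2)
    by (simp add: zero_le_mult_iff)
  \<comment> \<open>A mean-zero eigenfunction for \<open>x\<close> has Rayleigh quotient
    \<open>x\<close>, which the minimum cannot exceed.\<close>
  moreover have "e \<le> x" if "x \<in># proots (char_poly M)" for x
  proof -
    from that obtain g where g: "(\<Sum>a\<in>pverts G. g a) = 0" "\<exists>a\<in>pverts G. g a \<noteq> 0"
      and gl: "\<And>a. a \<in> pverts G \<Longrightarrow> laplacian G g a = x * g a" unfolding roots by blast
    have "(\<Sum>a\<in>pverts G. (g a)\<^sup>2) > 0"
      using g(2) pair_finite_verts by (auto intro: sum_pos2)
    then show ?thesis using low[OF g(1)] rayleigh_eigenfunction[OF gl] by simp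
  qed
  moreover have "e \<in># proots (char_poly M)"
  proof -
    have "\<exists>a\<in>pverts G. f a \<noteq> 0"
      using f(2) by (metis less_irrefl power_zero_numeral sum.neutral)
    then show ?thesis unfolding roots using f(1) lap by blast
  qed
  ultimately have "algebraic_connectivity G = e"
    unfolding algebraic_connectivity_def spec by (intro sorted_list_of_add_mset_nth_1) auto
  then show ?thesis using that f lap low by blast
qed

text \<open>An extremal function of \<open>H\<close> is a test function for \<open>G\<close>, and
  additional arcs only add nonnegative terms to its energy.\<close>

lemma algebraic_connectivity_mono:
  assumes "pair_graph G" "pair_graph H" "pverts G = pverts H" "parcs G \<subseteq> parcs H"
    and card: "2 \<le> card (pverts G)"
  shows "algebraic_connectivity G \<le> algebraic_connectivity H"
proof -
  interpret G: pair_graph G by fact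
  interpret H: pair_graph H by fact
  obtain f where f: "(\<Sum>a\<in>pverts H. f a) = 0" "(\<Sum>a\<in>pverts H. (f a)\<^sup>2) > 0"
    and lap: "\<And>a. a \<in> pverts H \<Longrightarrow> laplacian H f a = algebraic_connectivity H * f a"
    using H.algebraic_connectivity_rayleigh card assms(3) by metis
  have "algebraic_connectivity G * (\<Sum>a\<in>pverts H. (f a)\<^sup>2) \<le> dirichlet_form G f f"
    using G.algebraic_connectivity_rayleigh[OF card] f(1) assms(3) by metis
  also have "\<dots> \<le> dirichlet_form H f f"
    using assms(4) H.pair_finite_arcs by (rule dirichlet_form_mono[rotated])
  also have "\<dots> = algebraic_connectivity H * (\<Sum>a\<in>pverts H. (f a)\<^sup>2)"
    using H.rayleigh_eigenfunction[OF lap] .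
  finally show ?thesis using f(2) by simp
qed

section \<open>Token graphs\<close>

lemma pverts_token_graph: "pverts (token_graph k G) = {A. A \<subseteq> pverts G \<and> card A = k}"
  by (simp add: token_graph_def)

lemma pair_graph_token_graph:
  assumes "pair_graph G"
  shows "pair_graph (token_graph k G)"
proof -
  interpret pair_graph G by fact
  have fin: "finite (pverts (token_graph k G))"
    by (rule finite_subset[of _ "Pow (pverts G)"]) (auto simp: pverts_token_graph pair_finite_verts)
  have sub: "parcs (token_graph k G) \<subseteq> pverts (token_graph k G) \<times> pverts (token_graph k G)"
    by (auto simp: token_graph_def)
  show ?thesis
  proof
    show "finite (parcs (token_graph k G))"
      using finite_subset[OF sub] fin by blast
    show "symmetric (with_proj (token_graph k G))"
      by (simp add: symmetric_def sym_def token_graph_def Un_commute)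
    fix e assume e: "e \<in> parcs (token_graph k G)"
    then show "fst e \<in> pverts (token_graph k G)" "snd e \<in> pverts (token_graph k G)"
      using sub by auto
    from e obtain a b where "sym_diff (fst e) (snd e) = {a, b}"
      unfolding token_graph_def by (cases e) (simp, blast)
    then show "fst e \<noteq> snd e" by (metis Diff_cancel Un_absorb insert_not_empty)
  qed (fact fin)
qed

text \<open>Adjacency as the move of one token along an edge: equal cardinalities split the
  two-element symmetric difference evenly between \<open>A\<close> and \<open>B\<close>.\<close>

lemma (in pair_graph) token_graph_parcs_iff:
  assumes A: "A \<subseteq> pverts G" "card A = k"
  shows "(A, B) \<in> parcs (token_graph k G) \<longleftrightarrow>
    (\<exists>a b. a \<in> A \<and> b \<notin> A \<and> (a, b) \<in> parcs G \<and> B = insert b (A - {a}))"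
proof
  assume "(A, B) \<in> parcs (token_graph k G)"
  then obtain a b where B: "B \<subseteq> pverts G" "card B = k" and ab: "sym_diff A B = {a, b}"
    "(a, b) \<in> parcs G" by (auto simp: token_graph_def)
  have "a \<noteq> b" using pair_no_loops[OF ab(2)] by simp
  have fin: "finite A" "finite B" using A B pair_finite_verts by (auto intro: finite_subset)
  have eq: "card (A - B) = card (B - A)"
    using fin A B by (metis card_le_sym_Diff le_antisym le_refl)
  have U: "(A - B) \<union> (B - A) = {a, b}" "(A - B) \<inter> (B - A) = {}" using ab(1) by auto
  have "card (A - B) + card (B - A) = 2"
    using card_Un_disjoint[OF _ _ U(2)] fin U(1) \<open>a \<noteq> b\<close> by simp
  with eq have "card (A - B) = 1" "card (B - A) = 1" by auto
  then obtain x y where xy: "A - B = {x}" "B - A = {y}" by (auto simp: card_1_singleton_iff)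
  with U have "{x, y} = {a, b}" by auto
  \<comment> \<open>The definition leaves open which of \<open>a\<close> and \<open>b\<close> lies
    in \<open>A\<close>; symmetry of the arcs allows either orientation.\<close>
  then have "(x, y) \<in> parcs G" using ab(2) parcs_sym by (auto simp: doubleton_eq_iff)
  moreover have "B = insert y (A - {x})" "x \<in> A" "y \<notin> A" using xy by auto
  ultimately show "\<exists>a b. a \<in> A \<and> b \<notin> A \<and> (a, b) \<in> parcs G \<and> B = insert b (A - {a})" by blast
next
  assume "\<exists>a b. a \<in> A \<and> b \<notin> A \<and> (a, b) \<in> parcs G \<and> B = insert b (A - {a})"
  then obtain a b where ab: "a \<in> A" "b \<notin> A" "(a, b) \<in> parcs G" and B: "B = insert b (A - {a})"
    by blast
  have "finite A" using A pair_finite_verts by (auto intro: finite_subset)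
  then have "card B = k" using ab A unfolding B
    by (metis DiffE card.remove card_insert_disjoint finite_Diff)
  moreover have "B \<subseteq> pverts G" using ab A in_arcsD2 unfolding B by auto
  moreover have "sym_diff A B = {a, b}" using ab unfolding B by auto
  ultimately show "(A, B) \<in> parcs (token_graph k G)" using A ab(3) by (auto simp: token_graph_def)
qed

text \<open>Edges inside \<open>A\<close> contribute nothing to the sum of the Laplacian over \<open>A\<close> by
  antisymmetry, and the remaining edges are the possible token moves from \<open>A\<close>.\<close>

lemma (in pair_graph) laplacian_token_graph_lift:
  assumes A: "A \<in> pverts (token_graph k G)"
  shows "laplacian (token_graph k G) (sum f) A = (\<Sum>a\<in>A. laplacian G f a)"
proof -
  have A: "A \<subseteq> pverts G" "card A = k" using A by (auto simp: pverts_token_graph)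
  have fin: "finite A" using A pair_finite_verts by (auto intro: finite_subset)
  let ?N = "\<lambda>a. {b. (a, b) \<in> parcs G}"
  let ?out = "SIGMA a:A. ?N a - A" and ?ins = "SIGMA a:A. ?N a \<inter> A"
  let ?move = "\<lambda>(a, b). insert b (A - {a})"
  \<comment> \<open>The differences between \<open>A\<close> and the target set recover the vertex
    left and the vertex entered, so neighbours of \<open>A\<close> correspond to arcs leaving
    \<open>A\<close>.\<close>
  have bij: "bij_betw ?move ?out {B. (A, B) \<in> parcs (token_graph k G)}"
  proof (intro bij_betw_imageI inj_onI)
    fix x y assume "x \<in> ?out" "y \<in> ?out" "?move x = ?move y"
    then obtain a b c d where xy: "x = (a, b)" "y = (c, d)" "a \<in> A" "c \<in> A" "b \<notin> A" "d \<notin> A"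
      and eq: "insert b (A - {a}) = insert d (A - {c})" by (cases x; cases y) auto
    have "A - insert b (A - {a}) = {a}" "A - insert d (A - {c}) = {c}"
      "insert b (A - {a}) - A = {b}" "insert d (A - {c}) - A = {d}" using xy by auto
    with eq show "x = y" using xy(1,2) by auto
  next
    show "?move ` ?out = {B. (A, B) \<in> parcs (token_graph k G)}"
      by (auto simp: token_graph_parcs_iff[OF A] image_iff)
  qed
  have "laplacian (token_graph k G) (sum f) A = (\<Sum>x\<in>?out. sum f A - sum f (?move x))"
    unfolding laplacian_def by (rule sum.reindex_bij_betw[OF bij, symmetric])
  also have "\<dots> = (\<Sum>(a, b)\<in>?out. f a - f b)"
    using fin by (intro sum.cong) (auto simp: sum.remove)
  finally have 1: "laplacian (token_graph k G) (sum f) A = (\<Sum>(a, b)\<in>?out. f a - f b)" .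
  have "(\<Sum>(a, b)\<in>?ins. f a - f b) = (\<Sum>(a, b)\<in>?ins. f b - f a)"
    by (rule sum.reindex_bij_witness[of _ prod.swap prod.swap]) (auto intro: parcs_sym)
  moreover have "(\<Sum>(a, b)\<in>?ins. f b - f a) = - (\<Sum>(a, b)\<in>?ins. f a - f b)"
    unfolding sum_negf[symmetric] by (intro sum.cong) auto
  ultimately have 2: "(\<Sum>(a, b)\<in>?ins. f a - f b) = 0" by simp
  have "(\<Sum>a\<in>A. laplacian G f a) = (\<Sum>(a, b)\<in>(SIGMA a:A. ?N a). f a - f b)"
    unfolding laplacian_def using fin finite_neighbours by (intro sum.Sigma) auto
  also have "(SIGMA a:A. ?N a) = ?out \<union> ?ins" by auto
  also have "(\<Sum>(a, b)\<in>?out \<union> ?ins. f a - f b)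
      = (\<Sum>(a, b)\<in>?out. f a - f b) + (\<Sum>(a, b)\<in>?ins. f a - f b)"
    using fin finite_neighbours by (intro sum.union_disjoint finite_SigmaI) auto
  finally show ?thesis using 1 2 by simp
qed

section \<open>Comparing the token graph with its base graph\<close>

text \<open>Besides \<open>p\<close>, the remaining \<open>k - 1\<close> elements are chosen among
  the \<open>card V - 2\<close> vertices other than \<open>p\<close> and \<open>q\<close>.\<close>

lemma exists_subset_separating:
  assumes "finite V" "p \<in> V" "q \<in> V" "p \<noteq> q" "1 \<le> k" "k < card V"
  obtains A where "A \<subseteq> V" "card A = k" "p \<in> A" "q \<notin> A"
proof -
  have "k - 1 \<le> card (V - {p, q})" using assms by (simp add: card_Diff_subset)
  then obtain S where S: "S \<subseteq> V - {p, q}" "card S = k - 1" "finite S"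
    using obtain_subset_with_card_n by blast
  then have "card (insert p S) = k" using assms(5) by (subst card_insert_disjoint) auto
  with S assms show ?thesis by (intro that[of "insert p S"]) auto
qed

text \<open>Ensures that the token graph has a second eigenvalue: a set containing \<open>p\<close>
  but not \<open>q\<close> differs from one containing \<open>q\<close> but not
  \<open>p\<close>.\<close>

lemma (in pair_graph) card_token_graph_ge_2:
  assumes k: "1 \<le> k" "k < card (pverts G)"
  shows "2 \<le> card (pverts (token_graph k G))"
proof -
  have "\<not> card (pverts G) \<le> Suc 0" using k by simp
  then obtain p q where pq: "p \<in> pverts G" "q \<in> pverts G" "p \<noteq> q"
    using card_le_Suc0_iff_eq[OF pair_finite_verts] by blast
  obtain A where A: "A \<subseteq> pverts G" "card A = k" "p \<in> A" "q \<notin> A"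
    using exists_subset_separating[OF pair_finite_verts pq k] .
  obtain B where B: "B \<subseteq> pverts G" "card B = k" "q \<in> B" "p \<notin> B"
    using exists_subset_separating[OF pair_finite_verts pq(2,1) pq(3)[symmetric] k] .
  have "finite (pverts (token_graph k G))"
    by (rule finite_subset[of _ "Pow (pverts G)"]) (auto simp: pverts_token_graph pair_finite_verts)
  then have "card {A, B} \<le> card (pverts (token_graph k G))"
    using A B by (intro card_mono) (auto simp: pverts_token_graph)
  moreover have "A \<noteq> B" using A B by auto
  ultimately show ?thesis by simp
qed

text \<open>The lift \<open>sum f\<close> of an extremal eigenfunction is a test function on the
  token graph with the same Rayleigh quotient. It remains to see that it is nonzero and
  mean-zero.\<close>

lemma (in pair_graph) algebraic_connectivity_token_graph_le:
  assumes k: "1 \<le> k" "k < card (pverts G)"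
  shows "algebraic_connectivity (token_graph k G) \<le> algebraic_connectivity G"
proof -
  let ?T = "token_graph k G"
  interpret T: pair_graph ?T by (rule pair_graph_token_graph) unfold_locales
  let ?V = "pverts G" and ?W = "pverts ?T"
  have card: "2 \<le> card ?V" using k by simp
  obtain f where f: "(\<Sum>a\<in>?V. f a) = 0" "(\<Sum>a\<in>?V. (f a)\<^sup>2) > 0"
    and lap: "\<And>a. a \<in> ?V \<Longrightarrow> laplacian G f a = algebraic_connectivity G * f a"
    using algebraic_connectivity_rayleigh[OF card] by metis
  have "\<exists>p\<in>?V. \<exists>q\<in>?V. f p \<noteq> f q"
  proof (rule ccontr)
    assume "\<not> ?thesis"
    then have eq: "f p = f q" if "p \<in> ?V" "q \<in> ?V" for p q using that by blast
    have "f p = 0" if p: "p \<in> ?V" for p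
    proof -
      have "(\<Sum>a\<in>?V. f a) = (\<Sum>a\<in>?V. f p)" by (intro sum.cong refl eq p)
      then show ?thesis using f(1) card by auto
    qed
    then show False using f(2) by simp
  qed
  then obtain p q where pq: "p \<in> ?V" "q \<in> ?V" "f p \<noteq> f q" by blast
  then obtain A where A: "A \<subseteq> ?V" "card A = k" "p \<in> A" "q \<notin> A"
    using exists_subset_separating[OF pair_finite_verts, of p q k] k by blast
  have finA: "finite A" using A pair_finite_verts by (auto intro: finite_subset)
  \<comment> \<open>Exchanging \<open>p\<close> for \<open>q\<close> changes the lifted value by
    \<open>f q - f p\<close>, so the lift is nonzero at \<open>A\<close> or at
    \<open>B\<close>.\<close>
  define B where "B = insert q (A - {p})"
  have cB: "card B = k"
    unfolding B_def using A finA k(1) by (subst card_insert_disjoint) auto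
  have AB: "A \<in> ?W" "B \<in> ?W" "sum f A \<noteq> sum f B"
    using A pq cB finA by (auto simp: pverts_token_graph B_def sum.remove[of A p f])
  have cardT: "2 \<le> card ?W" using k by (rule card_token_graph_ge_2)
  have lift: "laplacian ?T (sum f) X = algebraic_connectivity G * sum f X" if "X \<in> ?W" for X
    unfolding laplacian_token_graph_lift[OF that] sum_distrib_left
    using that lap by (intro sum.cong) (auto simp: pverts_token_graph)
  have pos: "(\<Sum>X\<in>?W. (sum f X)\<^sup>2) > 0"
  proof -
    have "\<exists>X\<in>?W. sum f X \<noteq> 0" using AB by metis
    then show ?thesis using T.pair_finite_verts by (auto intro: sum_pos2)
  qed
  \<comment> \<open>Because \<open>f\<close> sums to zero, the lift at \<open>X\<close> is minus the
    sum over the complement of \<open>X\<close>. Every vertex is missed by equally many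
    \<open>k\<close>-subsets, so the double sum is a multiple of the total of
    \<open>f\<close>.\<close>
  have zero: "(\<Sum>X\<in>?W. sum f X) = 0"
  proof -
    have avoid: "card {X \<in> ?W. a \<notin> X} = (card ?V - 1) choose k" if "a \<in> ?V" for a
    proof -
      have "{X \<in> ?W. a \<notin> X} = {X. X \<subseteq> ?V - {a} \<and> card X = k}"
        by (auto simp: pverts_token_graph)
      then show ?thesis using n_subsets[of "?V - {a}" k] pair_finite_verts that by simp
    qed
    have "sum f X = - (\<Sum>a\<in>?V. if a \<notin> X then f a else 0)" if "X \<in> ?W" for X
    proof -
      have X: "X \<subseteq> ?V" using that by (auto simp: pverts_token_graph)
      have "(\<Sum>a\<in>?V. if a \<notin> X then f a else 0) = sum f (?V - X)"
        using pair_finite_verts by (intro sum.mono_neutral_cong_right) auto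
      then show ?thesis using sum.subset_diff[OF X pair_finite_verts, of f] f(1) by simp
    qed
    then have "(\<Sum>X\<in>?W. sum f X) = - (\<Sum>X\<in>?W. \<Sum>a\<in>?V. if a \<notin> X then f a else 0)"
      by (simp add: sum_negf)
    also have "\<dots> = - (\<Sum>a\<in>?V. \<Sum>X\<in>?W. if a \<notin> X then f a else 0)"
      by (subst sum.swap) (rule refl)
    also have "\<dots> = - (\<Sum>a\<in>?V. real ((card ?V - 1) choose k) * f a)"
      using avoid by (simp add: sum.inter_filter[OF T.pair_finite_verts, symmetric])
    also have "\<dots> = 0" by (simp add: f(1) flip: sum_distrib_left)
    finally show ?thesis .
  qed
  have "algebraic_connectivity ?T * (\<Sum>X\<in>?W. (sum f X)\<^sup>2) \<le> dirichlet_form ?T (sum f) (sum f)"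
    using T.algebraic_connectivity_rayleigh[OF cardT] zero by metis
  also have "\<dots> = algebraic_connectivity G * (\<Sum>X\<in>?W. (sum f X)\<^sup>2)"
    using T.rayleigh_eigenfunction[OF lift] .
  finally show ?thesis using pos by simp
qed

section \<open>Adding an edge\<close>

lemma pair_graph_add_edge:
  assumes "pair_graph G" "u \<in> pverts G" "v \<in> pverts G" "u \<noteq> v"
  shows "pair_graph (add_edge G u v)"
proof -
  interpret pair_graph G by fact
  show ?thesis
    by unfold_locales (use assms parcs_sym in \<open>auto simp: add_edge_def symmetric_def sym_def
      pair_finite_verts pair_finite_arcs dest: in_arcsD1 in_arcsD2 pair_no_loops\<close>)
qed

theorem theorem3p1:
  fixes G :: "'a pair_pre_digraph" and k :: nat and u v :: 'a
  assumes "pair_graph G"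
    and "2 \<le> k" and "real k \<le> real (card (pverts G)) / 2"
    and "algebraic_connectivity (token_graph k G) = algebraic_connectivity G"
    and "u \<in> pverts G" and "v \<in> pverts G" and "u \<noteq> v" and "(u, v) \<notin> parcs G"
    and "algebraic_connectivity (add_edge G u v) = algebraic_connectivity G"
  shows "algebraic_connectivity (token_graph k (add_edge G u v))
       = algebraic_connectivity (add_edge G u v)"
proof -
  let ?H = "add_edge G u v"
  have H: "pair_graph ?H" using assms by (intro pair_graph_add_edge)
  have verts: "pverts ?H = pverts G" by (simp add: add_edge_def)
  have k: "1 \<le> k" "k < card (pverts G)" using assms(2,3) by linarith+
  \<comment> \<open>Both token graphs have the same vertices, and every token move in
    \<open>G\<close> remains a move after the edge is added.\<close>
  have "algebraic_connectivity (token_graph k G) \<le> algebraic_connectivity (token_graph k ?H)"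
    using assms(1) H pair_graph.card_token_graph_ge_2[OF assms(1) k]
    by (intro algebraic_connectivity_mono pair_graph_token_graph)
      (auto simp: token_graph_def add_edge_def)
  moreover have "algebraic_connectivity (token_graph k ?H) \<le> algebraic_connectivity ?H"
    using k by (intro pair_graph.algebraic_connectivity_token_graph_le[OF H]) (auto simp: verts)
  ultimately show ?thesis using assms(4,9) by simp
qed

end
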